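(* For any $p>0$, there exists some $c=c(p)>0$ such that, for every integer $n\ge2$ and every $M_p>0$ satisfying $n^{-1/p}(\log n)^{10}\le M_p^{1/p}\le n^2(\log n)^2$, $$\inf_{\hat f}\ \sup_{G\in\mathcal{G}_p(M_p)}\mathbb{E}_G H^2(\hat f,f_G)\ \ge\ c\,n^{-2p/(2p+1)}M_p^{1/(2p+1)}(\log n)^{-11},$$ where the infimum is over all density estimates $\hat f$ (random probability mass functions on $\mathbb{Z}_+$) measurable with respect to $Y^n=(Y_1,\ldots,Y_n)$, i.i.d. from $f_G$.
   Context: $\mathbb{R}_+=[0,\infty)$, $\mathbb{Z}_+=\{0,1,2,\ldots\}$. $\mathcal{P}(\mathbb{R}_+)$ is the set of Borel probability measures on $\mathbb{R}_+$. $\mathrm{Poi}(y;\theta)=e^{-\theta}\theta^y/y!$ for $y\in\mathbb{Z}_+$, $\theta\ge 0$ (with $0^0=1$). For $G\in\mathcal{P}(\mathbb{R}_+)$ the Poisson mixture is $f_G(y)=\int \mathrm{Poi}(y;\theta)\,G(d\theta)$, and $m_p(G)=\int u^p\,G(du)$. $\mathcal{G}_p(M_p)=\{G\in\mathcal{P}(\mathbb{R}_+): m_p(G)\le M_p\}$. The squared Hellinger distance is $H^2(f,g)=\sum_{y\ge 0}(\sqrt{f(y)}-\sqrt{g(y)})^2$. $\mathbb{E}_G$ is with respect to $Y_1,\ldots,Y_n$ i.i.d. from $f_G$. *)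

theory Defs
  imports "HOL-Probability.Probability"
begin

definition poisson_mass :: "nat \<Rightarrow> real \<Rightarrow> real" where
  "poisson_mass y \<theta> = exp (- \<theta>) * \<theta> ^ y / fact y"

definition nonneg_prob_measures :: "real measure set" where
  "nonneg_prob_measures =
     {G. prob_space G \<and> sets G = sets (restrict_space borel {0::real..})}"

definition poisson_mixture :: "real measure \<Rightarrow> nat \<Rightarrow> real" where
  "poisson_mixture G y = (\<integral>\<theta>. poisson_mass y \<theta> \<partial>G)"

(* The moment may be infinite, hence its type. *)
definition moment :: "real \<Rightarrow> real measure \<Rightarrow> ennreal" where
  "moment p G = (\<integral>\<^sup>+u. ennreal (u powr p) \<partial>G)"

definition moment_class :: "real \<Rightarrow> real \<Rightarrow> real measure set" where
  "moment_class p M = {G \<in> nonneg_prob_measures. moment p G \<le> ennreal M}"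

definition hellinger_sq :: "(nat \<Rightarrow> real) \<Rightarrow> (nat \<Rightarrow> real) \<Rightarrow> real" where
  "hellinger_sq f g = (\<Sum>y. (sqrt (f y) - sqrt (g y))\<^sup>2)"

(* embed_pmf is only meaningful for genuine mass functions; this is justified for
   every G in nonneg_prob_measures by pmf_mixture_pmf below. *)
definition mixture_pmf :: "real measure \<Rightarrow> nat pmf" where
  "mixture_pmf G = embed_pmf (poisson_mixture G)"

definition sample_law :: "nat \<Rightarrow> real measure \<Rightarrow> (nat \<Rightarrow> nat) measure" where
  "sample_law n G = (\<Pi>\<^sub>M i\<in>{..<n}. measure_pmf (mixture_pmf G))"

(* An estimate that is measurable with respect to the sample is a measurable function
   of it; measurability of a random mass function is that of each of its values. *)
definition density_estimates :: "nat \<Rightarrow> ((nat \<Rightarrow> nat) \<Rightarrow> nat pmf) set" where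
  "density_estimates n =
     {fhat. \<forall>y. (\<lambda>Y. pmf (fhat Y) y)
        \<in> borel_measurable (\<Pi>\<^sub>M i\<in>{..<n}. count_space (UNIV :: nat set))}"

definition hellinger_risk ::
    "nat \<Rightarrow> ((nat \<Rightarrow> nat) \<Rightarrow> nat pmf) \<Rightarrow> real measure \<Rightarrow> ennreal" where
  "hellinger_risk n fhat G =
     (\<integral>\<^sup>+Y. ennreal (hellinger_sq (pmf (fhat Y)) (poisson_mixture G)) \<partial>sample_law n G)"

lemma poisson_mass_sums: "poisson_mass y \<theta> \<ge> 0" "(\<lambda>y. poisson_mass y \<theta>) sums 1"
  if "\<theta> \<ge> 0"
proof -
  show "poisson_mass y \<theta> \<ge> 0" using that by (simp add: poisson_mass_def)
  have "(\<lambda>y. \<theta> ^ y /\<^sub>R fact y) sums exp \<theta>" by (rule exp_converges)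
  then have "(\<lambda>y. exp (- \<theta>) * (\<theta> ^ y /\<^sub>R fact y)) sums (exp (- \<theta>) * exp \<theta>)"
    by (rule sums_mult)
  then show "(\<lambda>y. poisson_mass y \<theta>) sums 1"
    by (simp add: poisson_mass_def exp_minus field_simps)
qed

lemma poisson_mixture_nonneg:
  assumes "G \<in> nonneg_prob_measures"
  shows "poisson_mixture G y \<ge> 0"
proof -
  have "space G = {0..}"
    using assms sets_eq_imp_space_eq[of G "restrict_space borel {0::real..}"]
    by (simp add: nonneg_prob_measures_def space_restrict_space)
  then show ?thesis
    unfolding poisson_mixture_def
    by (intro Bochner_Integration.integral_nonneg) (auto intro: poisson_mass_sums)
qed

lemma pmf_mixture_pmf:
  assumes G: "G \<in> nonneg_prob_measures"
  shows "pmf (mixture_pmf G) = poisson_mixture G"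
proof -
  interpret prob_space G using G by (simp add: nonneg_prob_measures_def)
  have sets: "sets G = sets (restrict_space borel {0::real..})"
    using G by (simp add: nonneg_prob_measures_def)
  have space: "space G = {0..}"
    using sets_eq_imp_space_eq[OF sets] by (simp add: space_restrict_space)
  have meas: "poisson_mass y \<in> borel_measurable G" for y
  proof -
    have "poisson_mass y \<in> borel_measurable (restrict_space borel {0::real..})"
      unfolding poisson_mass_def[abs_def] by (intro measurable_restrict_space1) measurable
    then show ?thesis using measurable_cong_sets[OF sets refl] by blast
  qed
  have le1: "poisson_mass y \<theta> \<le> 1" if "\<theta> \<ge> 0" for y \<theta>
    using sum_le_suminf[OF sums_summable[OF poisson_mass_sums(2)[OF that]], of "{y}"]
      poisson_mass_sums[OF that] by (simp add: sums_iff)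
  have int: "integrable G (poisson_mass y)" for y
    by (rule integrable_const_bound[where B=1])
       (auto simp: meas space poisson_mass_sums le1)
  have mix: "ennreal (poisson_mixture G y) = (\<integral>\<^sup>+\<theta>. ennreal (poisson_mass y \<theta>) \<partial>G)" for y
  proof -
    have "AE \<theta> in G. 0 \<le> poisson_mass y \<theta>"
      by (rule AE_I2) (simp add: space poisson_mass_sums)
    from nn_integral_eq_integral[OF int this] show ?thesis
      by (simp only: poisson_mixture_def)
  qed
  have sum1: "(\<Sum>y. ennreal (poisson_mass y \<theta>)) = 1" if "\<theta> \<in> space G" for \<theta>
  proof -
    have "\<theta> \<ge> 0" using that by (simp add: space)
    from suminf_ennreal_eq[OF poisson_mass_sums[OF this]] show ?thesis by simp
  qed
  have "(\<integral>\<^sup>+y. ennreal (poisson_mixture G y) \<partial>count_space UNIV)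
        = (\<Sum>y. \<integral>\<^sup>+\<theta>. ennreal (poisson_mass y \<theta>) \<partial>G)"
    by (simp only: nn_integral_count_space_nat mix)
  also have "\<dots> = (\<integral>\<^sup>+\<theta>. (\<Sum>y. ennreal (poisson_mass y \<theta>)) \<partial>G)"
    by (rule nn_integral_suminf[symmetric]) (rule measurable_compose[OF meas measurable_ennreal])
  also have "\<dots> = (\<integral>\<^sup>+\<theta>. 1 \<partial>G)"
    by (rule nn_integral_cong) (rule sum1)
  also have "\<dots> = 1" by (simp add: emeasure_space_1)
  finally have total: "(\<integral>\<^sup>+y. ennreal (poisson_mixture G y) \<partial>count_space UNIV) = 1" .
  show ?thesis
    unfolding mixture_pmf_def
    by (rule ext, rule pmf_embed_pmf[OF poisson_mixture_nonneg[OF G] total])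
qed

end

theory Submission
  imports Defs
begin

text \<open>Let $U$ be uniform on $2n$ indices, let $K \le 2n$, and for $S \subseteq \{0,\dots,K-1\}$ let
  $G_S$ be the law of $\theta_U$ if $U \in S$ and of $0$ otherwise. Adding one index to $S$ moves
  mass $1/(2n)$, so the two laws of $n$ observations overlap in mass at least $1/2$. If the Poisson
  laws with means $\theta_k$ live on disjoint bins $I_k$ that avoid $0$, then each of the $K$ indices
  costs squared Hellinger loss of order $1/n$ on its bin, and Assouad's argument gives risk of order
  $K/n$. Since a Poisson law has standard deviation $\sqrt\theta$, one can take $\theta_k$ to be
  four times consecutive squares; the moment constraint then reads $K^{2p+1} \lesssim nM$. When this
  leaves no room for a single bin, one atom at a small constant suffices.\<close>

section \<open>Moments and concentration of the Poisson law\<close>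

lemma poisson_mass_0: "poisson_mass y 0 = (if y = 0 then 1 else 0)"
  by (simp add: poisson_mass_def)

text \<open>Trades a factor \<open>y\<close> for a factor \<open>\<theta>\<close> and an index
  shift, which reduces the first two moments to the total mass.\<close>

lemma poisson_mass_Suc: "real (Suc y) * poisson_mass (Suc y) \<theta> = \<theta> * poisson_mass y \<theta>"
  by (simp add: poisson_mass_def divide_simps)

lemma poisson_mean_sums:
  assumes "\<theta> \<ge> 0"
  shows "(\<lambda>y. real y * poisson_mass y \<theta>) sums \<theta>"
proof -
  have "(\<lambda>y. real (Suc y) * poisson_mass (Suc y) \<theta>) sums (\<theta> * 1)"
    unfolding poisson_mass_Suc by (intro sums_mult poisson_mass_sums(2) assms)
  then show ?thesis
    by (subst (asm) sums_Suc_iff) simp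
qed

lemma poisson_second_moment_sums:
  assumes "\<theta> \<ge> 0"
  shows "(\<lambda>y. (real y)\<^sup>2 * poisson_mass y \<theta>) sums (\<theta> * (\<theta> + 1))"
proof -
  have "(real (Suc y))\<^sup>2 * poisson_mass (Suc y) \<theta>
      = \<theta> * (real y * poisson_mass y \<theta> + poisson_mass y \<theta>)" for y
  proof -
    have "(real (Suc y))\<^sup>2 * poisson_mass (Suc y) \<theta>
        = real (Suc y) * (real (Suc y) * poisson_mass (Suc y) \<theta>)"
      by (simp only: power2_eq_square mult.assoc)
    then show ?thesis
      unfolding poisson_mass_Suc by (simp add: algebra_simps)
  qed
  then have "(\<lambda>y. (real (Suc y))\<^sup>2 * poisson_mass (Suc y) \<theta>) sums (\<theta> * (\<theta> + 1))"
    by (simp only:) (intro sums_mult sums_add poisson_mean_sums poisson_mass_sums(2) assms)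
  then show ?thesis
    by (subst (asm) sums_Suc_iff) simp
qed

lemma poisson_variance_sums:
  assumes "\<theta> \<ge> 0"
  shows "(\<lambda>y. (real y - \<theta>)\<^sup>2 * poisson_mass y \<theta>) sums \<theta>"
proof -
  have "(\<lambda>y. (real y)\<^sup>2 * poisson_mass y \<theta> - 2 * \<theta> * (real y * poisson_mass y \<theta>)
      + \<theta>\<^sup>2 * poisson_mass y \<theta>) sums (\<theta> * (\<theta> + 1) - 2 * \<theta> * \<theta> + \<theta>\<^sup>2 * 1)"
    by (intro sums_add sums_diff sums_mult poisson_second_moment_sums poisson_mean_sums
        poisson_mass_sums(2) assms)
  then show ?thesis
    by (simp add: power2_eq_square algebra_simps)
qed

text \<open>The function 1 - (y - \<open>\<theta>\<close>)^2 / b^2 lies below the indicator of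
  \<open>I\<close>; summing it against the Poisson masses brings in the variance
  \<open>\<theta>\<close>.\<close>

lemma poisson_chebyshev:
  assumes "\<theta> \<ge> 0" "b > 0" "finite I" "\<And>y. \<bar>real y - \<theta>\<bar> < b \<Longrightarrow> y \<in> I"
  shows "1 - \<theta> / b\<^sup>2 \<le> (\<Sum>y\<in>I. poisson_mass y \<theta>)"
proof -
  have 1: "(\<lambda>y. poisson_mass y \<theta> - (real y - \<theta>)\<^sup>2 * poisson_mass y \<theta> / b\<^sup>2) sums (1 - \<theta> / b\<^sup>2)"
    by (intro sums_diff sums_divide poisson_variance_sums poisson_mass_sums(2) assms)
  have 2: "(\<lambda>y. if y \<in> I then poisson_mass y \<theta> else 0) sums (\<Sum>y\<in>I. poisson_mass y \<theta>)"
    by (rule sums_If_finite_set) fact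
  have "poisson_mass y \<theta> - (real y - \<theta>)\<^sup>2 * poisson_mass y \<theta> / b\<^sup>2
      \<le> (if y \<in> I then poisson_mass y \<theta> else 0)" for y
  proof (cases "y \<in> I")
    case False
    then have "b \<le> \<bar>real y - \<theta>\<bar>" using assms(4)[of y] by linarith
    then have "b\<^sup>2 \<le> (real y - \<theta>)\<^sup>2" using \<open>b > 0\<close> by (simp add: abs_le_square_iff[symmetric])
    then have "1 * poisson_mass y \<theta> \<le> (real y - \<theta>)\<^sup>2 / b\<^sup>2 * poisson_mass y \<theta>"
      using assms by (intro mult_right_mono poisson_mass_sums(1)) auto
    then show ?thesis using False by simp
  qed (use assms poisson_mass_sums(1)[OF assms(1)] in auto)
  from sums_le[OF this 1 2] show ?thesis .
qed

section \<open>Le Cam's two-point bound for product measures\<close>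

text \<open>One coordinate is split off by Fubini: the induction hypothesis replaces the outer
  factors, the one-dimensional comparison replaces the inner one. Sigma-finiteness is all that is
  asked of the factors, so the smaller ones may be sub-probability measures.\<close>

lemma nn_integral_PiM_mono_measure:
  assumes M: "product_sigma_finite M" and N: "product_sigma_finite N"
    and sets: "\<And>i. sets (M i) = sets (N i)" and le: "\<And>i. M i \<le> N i"
    and "finite I" and "g \<in> borel_measurable (Pi\<^sub>M I M)"
  shows "integral\<^sup>N (Pi\<^sub>M I M) g \<le> integral\<^sup>N (Pi\<^sub>M I N) g"
  using \<open>finite I\<close> \<open>g \<in> borel_measurable (Pi\<^sub>M I M)\<close>
proof (induction I arbitrary: g rule: finite_induct)
  case empty
  show ?case
    by (simp add: PiM_empty)
next
  case (insert i I)
  have cong: "sets (Pi\<^sub>M J M) = sets (Pi\<^sub>M J N)" for J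
    by (intro sets_PiM_cong refl sets)
  have g[measurable]: "g \<in> borel_measurable (Pi\<^sub>M (insert i I) M)" by fact
  have g'[measurable]: "g \<in> borel_measurable (Pi\<^sub>M (insert i I) N)"
    using g by (simp cong: measurable_cong_sets add: cong)
  have 1: "(\<lambda>x. \<integral>\<^sup>+y. g (x(i := y)) \<partial>M i) \<in> borel_measurable (Pi\<^sub>M I M)"
  proof -
    interpret product_sigma_finite M by (rule M)
    have "(\<lambda>(x, y). g (x(i := y))) \<in> borel_measurable (Pi\<^sub>M I M \<Otimes>\<^sub>M M i)"
      by measurable
    then show ?thesis
      by (rule sigma_finite_measure.borel_measurable_nn_integral[OF sigma_finite_measures])
  qed
  have "integral\<^sup>N (Pi\<^sub>M (insert i I) M) g = (\<integral>\<^sup>+x. \<integral>\<^sup>+y. g (x(i := y)) \<partial>M i \<partial>Pi\<^sub>M I M)"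
    by (rule product_sigma_finite.product_nn_integral_insert[OF M insert.hyps g])
  also have "\<dots> \<le> (\<integral>\<^sup>+x. \<integral>\<^sup>+y. g (x(i := y)) \<partial>M i \<partial>Pi\<^sub>M I N)"
    by (rule insert.IH[OF 1])
  also have "\<dots> \<le> (\<integral>\<^sup>+x. \<integral>\<^sup>+y. g (x(i := y)) \<partial>N i \<partial>Pi\<^sub>M I N)"
    by (intro nn_integral_mono nn_integral_mono_measure sets le)
  also have "\<dots> = integral\<^sup>N (Pi\<^sub>M (insert i I) N) g"
    by (rule product_sigma_finite.product_nn_integral_insert[OF N insert.hyps g', symmetric])
  finally show ?case .
qed

text \<open>The common part of \<open>P\<close> and \<open>Q\<close>, with density the pointwise
  minimum, lies below both laws, so its product lies below both product laws. Integrating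
  \<open>d \<le> \<phi> Y + \<psi> Y\<close> against that product gives the bound directly, because
  its total mass is a power of the one-observation overlap.\<close>

lemma pmf_product_le_cam:
  fixes P Q :: "nat pmf" and I :: "'i set"
  assumes "finite I"
    and [measurable]: "\<phi> \<in> borel_measurable (\<Pi>\<^sub>M i\<in>I. count_space (UNIV :: nat set))"
      "\<psi> \<in> borel_measurable (\<Pi>\<^sub>M i\<in>I. count_space (UNIV :: nat set))"
    and d: "\<And>Y. d \<le> \<phi> Y + \<psi> Y"
  shows "d * (\<Sum>y. ennreal (min (pmf P y) (pmf Q y))) ^ card I
     \<le> (\<integral>\<^sup>+Y. \<phi> Y \<partial>(\<Pi>\<^sub>M i\<in>I. measure_pmf P)) + (\<integral>\<^sup>+Y. \<psi> Y \<partial>(\<Pi>\<^sub>M i\<in>I. measure_pmf Q))"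
proof -
  define \<nu> where "\<nu> = density (count_space UNIV) (\<lambda>y. ennreal (min (pmf P y) (pmf Q y)))"
  have \<nu>_le: "\<nu> \<le> measure_pmf R" if "R = P \<or> R = Q" for R
  proof -
    have "emeasure \<nu> A \<le> emeasure (measure_pmf R) A" for A
      using that unfolding \<nu>_def measure_pmf_eq_density
      by (auto simp: emeasure_density intro!: nn_integral_mono mult_right_mono ennreal_leI)
    then show ?thesis by (subst le_measure) (auto simp: \<nu>_def)
  qed
  have "emeasure \<nu> (space \<nu>) \<le> emeasure (measure_pmf P) (space \<nu>)"
    by (rule le_measureD3) (auto simp: \<nu>_le, simp add: \<nu>_def)
  also have "\<dots> \<le> 1" by (rule measure_pmf.emeasure_le_1)
  finally interpret \<nu>: finite_measure \<nu>
    by (intro finite_measureI) (auto simp: top_unique)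
  have psf: "product_sigma_finite (\<lambda>i::'i. \<nu>)"
    by unfold_locales
  have psfR: "product_sigma_finite (\<lambda>i::'i. measure_pmf R)" for R :: "nat pmf"
    by unfold_locales
  have sets: "sets \<nu> = UNIV" "space \<nu> = UNIV" by (auto simp: \<nu>_def)
  have cong: "sets (\<Pi>\<^sub>M i\<in>I. \<nu>) = sets (\<Pi>\<^sub>M i\<in>I. count_space UNIV)"
    by (intro sets_PiM_cong) (auto simp: sets)
  have meas[measurable]: "\<phi> \<in> borel_measurable (\<Pi>\<^sub>M i\<in>I. \<nu>)" "\<psi> \<in> borel_measurable (\<Pi>\<^sub>M i\<in>I. \<nu>)"
    using assms(2,3) by (simp_all add: measurable_cong_sets[OF cong refl])
  have tot: "emeasure \<nu> UNIV = (\<Sum>y. ennreal (min (pmf P y) (pmf Q y)))"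
    by (simp add: \<nu>_def emeasure_density nn_integral_count_space_nat)
  have "emeasure (\<Pi>\<^sub>M i\<in>I. \<nu>) (space (\<Pi>\<^sub>M i\<in>I. \<nu>)) = emeasure \<nu> UNIV ^ card I"
    using product_sigma_finite.emeasure_PiM[OF psf \<open>finite I\<close>, of "\<lambda>_. UNIV"]
    by (simp add: space_PiM sets)
  then have "d * (\<Sum>y. ennreal (min (pmf P y) (pmf Q y))) ^ card I = (\<integral>\<^sup>+Y. d \<partial>(\<Pi>\<^sub>M i\<in>I. \<nu>))"
    by (simp add: tot)
  also have "\<dots> \<le> (\<integral>\<^sup>+Y. \<phi> Y + \<psi> Y \<partial>(\<Pi>\<^sub>M i\<in>I. \<nu>))"
    by (intro nn_integral_mono d)
  also have "\<dots> = (\<integral>\<^sup>+Y. \<phi> Y \<partial>(\<Pi>\<^sub>M i\<in>I. \<nu>)) + (\<integral>\<^sup>+Y. \<psi> Y \<partial>(\<Pi>\<^sub>M i\<in>I. \<nu>))"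
    by (rule nn_integral_add) measurable
  also have "\<dots> \<le> (\<integral>\<^sup>+Y. \<phi> Y \<partial>(\<Pi>\<^sub>M i\<in>I. measure_pmf P)) + (\<integral>\<^sup>+Y. \<psi> Y \<partial>(\<Pi>\<^sub>M i\<in>I. measure_pmf Q))"
    by (intro add_mono nn_integral_PiM_mono_measure psf psfR \<nu>_le meas \<open>finite I\<close>) (auto simp: sets)
  finally show ?thesis .
qed

section \<open>Sparse priors: overlap and Hellinger separation of neighbours\<close>

text \<open>A linearised form of D^2 / (4 F), which is the value at t = D / F. It involves no
  division by \<open>F\<close> and is linear in \<open>D\<close> and \<open>F\<close>, so it can be
  summed over a bin with one common \<open>t\<close>. With D = u v and v^2 at most 4 F it follows
  from (u - t v / 4)^2 being nonnegative.\<close>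

lemma sqrt_diff_sq_ge:
  fixes a D F t :: real
  assumes "a \<ge> 0" "D \<ge> 0" "a + D \<le> F"
  shows "(2 * t * D - t\<^sup>2 * F) / 4 \<le> (sqrt a - sqrt (a + D))\<^sup>2"
proof -
  define u v where "u = sqrt (a + D) - sqrt a" and "v = sqrt (a + D) + sqrt a"
  have uv: "u * v = D"
    using assms by (simp add: u_def v_def algebra_simps)
  have "v\<^sup>2 \<le> (2 * sqrt (a + D))\<^sup>2"
    using assms by (intro power_mono) (auto simp: v_def)
  also have "\<dots> \<le> 4 * F" using assms by (simp add: power_mult_distrib)
  finally have "t\<^sup>2 * v\<^sup>2 \<le> t\<^sup>2 * (4 * F)" by (intro mult_left_mono) auto
  moreover have "0 \<le> (u - t / 4 * v)\<^sup>2" by simp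
  then have "t * D / 2 - t\<^sup>2 * v\<^sup>2 / 16 \<le> u\<^sup>2"
    unfolding uv[symmetric] by (simp add: power2_eq_square algebra_simps)
  ultimately have "(2 * t * D - t\<^sup>2 * F) / 4 \<le> u\<^sup>2" by (simp add: field_simps)
  then show ?thesis by (simp add: u_def power2_commute)
qed

text \<open>As a pushforward of a uniform index, every integral against it becomes a finite average.
  The target is the sigma-algebra that \<open>nonneg_prob_measures\<close> prescribes.\<close>

definition sparse_prior :: "nat \<Rightarrow> (nat \<Rightarrow> real) \<Rightarrow> nat set \<Rightarrow> real measure" where
  "sparse_prior N \<theta> S = distr (measure_pmf (pmf_of_set {..<N})) (restrict_space borel {0..})
     (\<lambda>i. if i \<in> S then \<theta> i else 0)"

context
  fixes N :: nat and \<theta> :: "nat \<Rightarrow> real"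
  assumes N: "N > 0" and \<theta>: "\<And>i. \<theta> i \<ge> 0"
begin

lemma sparse_prior_measurable:
  "(\<lambda>i. if i \<in> S then \<theta> i else 0) \<in> measurable (measure_pmf P) (restrict_space borel {0..})"
  using \<theta> by (auto simp: measurable_restrict_space2_iff)

lemma sparse_prior_prob: "sparse_prior N \<theta> S \<in> nonneg_prob_measures"
  unfolding nonneg_prob_measures_def sparse_prior_def
  using measure_pmf.prob_space_distr[OF sparse_prior_measurable] by simp

lemma poisson_mixture_sparse_prior:
  "poisson_mixture (sparse_prior N \<theta> S) y
     = (\<Sum>i<N. poisson_mass y (if i \<in> S then \<theta> i else 0)) / real N"
proof -
  have "poisson_mass y \<in> borel_measurable (restrict_space borel {0::real..})"
    unfolding poisson_mass_def[abs_def] by (intro measurable_restrict_space1) measurable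
  then show ?thesis
    unfolding poisson_mixture_def sparse_prior_def using N lessThan_empty_iff[of N]
    by (subst integral_distr[OF sparse_prior_measurable]) (auto simp: integral_pmf_of_set)
qed

lemma moment_sparse_prior:
  "moment p (sparse_prior N \<theta> S) = ennreal ((\<Sum>i<N. (if i \<in> S then \<theta> i else 0) powr p) / real N)"
proof -
  have "(\<lambda>u. ennreal (u powr p)) \<in> borel_measurable (restrict_space borel {0::real..})"
    by (intro measurable_restrict_space1) measurable
  then show ?thesis
    unfolding moment_def sparse_prior_def using N lessThan_empty_iff[of N]
    by (subst nn_integral_distr[OF sparse_prior_measurable])
       (auto simp: nn_integral_pmf_of_set sum_ennreal divide_ennreal[symmetric]
        ennreal_of_nat_eq_real_of_nat[symmetric] sum_nonneg)
qed

abbreviation (input) mix where "mix S y \<equiv> poisson_mixture (sparse_prior N \<theta> S) y"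

text \<open>Separates the contribution \<open>h\<close> of the other indices, shared by both
  mixtures, from that of index \<open>k\<close>, whose atom moves from 0 to
  \<open>\<theta> k\<close>.\<close>

lemma sparse_prior_insert:
  assumes "k < N" "k \<notin> S"
  defines "h \<equiv> \<lambda>y. (\<Sum>i\<in>{..<N} - {k}. poisson_mass y (if i \<in> S then \<theta> i else 0)) / real N"
  shows "mix S y = h y + poisson_mass y 0 / real N"
    and "mix (insert k S) y = h y + poisson_mass y (\<theta> k) / real N"
proof -
  have split: "(\<Sum>i<N. g i) = g k + (\<Sum>i\<in>{..<N} - {k}. g i)" for g :: "nat \<Rightarrow> real"
    using assms(1) by (intro sum.remove) auto
  show "mix S y = h y + poisson_mass y 0 / real N"
    unfolding poisson_mixture_sparse_prior h_def split using assms(2) by (simp add: add_divide_distrib)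
  have "(\<Sum>i\<in>{..<N} - {k}. poisson_mass y (if i \<in> insert k S then \<theta> i else 0))
      = (\<Sum>i\<in>{..<N} - {k}. poisson_mass y (if i \<in> S then \<theta> i else 0))"
    by (intro sum.cong) auto
  then show "mix (insert k S) y = h y + poisson_mass y (\<theta> k) / real N"
    unfolding poisson_mixture_sparse_prior h_def split by (simp add: add_divide_distrib)
qed

text \<open>Both mixtures dominate the shared part \<open>h\<close>, which has total mass (N - 1) /
  N.\<close>

lemma sparse_prior_overlap:
  assumes "k < N" "k \<notin> S"
  shows "ennreal (1 - 1 / real N) \<le> (\<Sum>y. ennreal (min (mix S y) (mix (insert k S) y)))"
proof -
  define h where "h y = (\<Sum>i\<in>{..<N} - {k}. poisson_mass y (if i \<in> S then \<theta> i else 0)) / real N" for y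
  have h0: "h y \<ge> 0" for y
    unfolding h_def using \<theta> by (intro divide_nonneg_nonneg sum_nonneg poisson_mass_sums(1)) auto
  have "h sums ((\<Sum>i\<in>{..<N} - {k}. 1) / real N)"
    unfolding h_def using \<theta> by (intro sums_divide sums_sum poisson_mass_sums(2)) auto
  also have "(\<Sum>i\<in>{..<N} - {k}. 1) / real N = 1 - 1 / real N"
    using assms(1) by (simp add: field_simps of_nat_diff)
  finally have "ennreal (1 - 1 / real N) = (\<Sum>y. ennreal (h y))"
    using suminf_ennreal_eq[OF h0] by simp
  also have "\<dots> \<le> (\<Sum>y. ennreal (min (mix S y) (mix (insert k S) y)))"
    unfolding sparse_prior_insert[OF assms] h_def[symmetric]
    by (intro suminf_le ennreal_leI) (auto simp: poisson_mass_sums(1) \<theta>)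
  finally show ?thesis .
qed

text \<open>At positive \<open>y\<close> the atom at 0 is invisible, so inserting \<open>k\<close>
  adds exactly \<open>poisson_mass y (\<theta> k) / real N\<close>, and the result stays below the
  contribution of all \<open>K\<close> components together. The lower bound is therefore the same
  for every \<open>S\<close>.\<close>

lemma sparse_prior_sqrt_diff:
  assumes "K \<le> N" "S \<subseteq> {..<K}" "k < K" "k \<notin> S" "y > 0"
  shows "(2 * q * poisson_mass y (\<theta> k) - q\<^sup>2 * (\<Sum>j<K. poisson_mass y (\<theta> j))) / (4 * real N)
     \<le> (sqrt (mix S y) - sqrt (mix (insert k S) y))\<^sup>2"
proof -
  have kN: "k < N" using assms by simp
  have y0: "poisson_mass y 0 = 0" using \<open>y > 0\<close> by (simp add: poisson_mass_0)
  have ins: "mix (insert k S) y = mix S y + poisson_mass y (\<theta> k) / real N"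
    using sparse_prior_insert[OF kN \<open>k \<notin> S\<close>, of y] y0 by simp
  have "mix (insert k S) y \<le> (\<Sum>j<K. poisson_mass y (\<theta> j)) / real N"
  proof -
    have "(\<Sum>i<N. poisson_mass y (if i \<in> insert k S then \<theta> i else 0))
        = (\<Sum>i\<in>{..<N} \<inter> insert k S. poisson_mass y (\<theta> i))"
      using y0 by (simp add: sum.inter_restrict if_distrib cong: if_cong)
    also have "\<dots> \<le> (\<Sum>j<K. poisson_mass y (\<theta> j))"
      using assms \<theta> by (intro sum_mono2) (auto simp: poisson_mass_sums(1))
    finally show ?thesis
      unfolding poisson_mixture_sparse_prior using N by (simp add: divide_right_mono)
  qed
  then have "(2 * q * (poisson_mass y (\<theta> k) / real N)
      - q\<^sup>2 * ((\<Sum>j<K. poisson_mass y (\<theta> j)) / real N)) / 4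
      \<le> (sqrt (mix S y) - sqrt (mix S y + poisson_mass y (\<theta> k) / real N))\<^sup>2"
    unfolding ins using \<theta>
    by (intro sqrt_diff_sq_ge poisson_mixture_nonneg sparse_prior_prob divide_nonneg_nonneg
        poisson_mass_sums(1)) auto
  then show ?thesis unfolding ins by (simp add: diff_divide_distrib)
qed

end

section \<open>Assouad's argument over the cube of subsets\<close>

text \<open>No sign is assumed: \<open>ennreal\<close> truncates negative terms to 0, which can only
  enlarge the right side.\<close>

lemma sum_ennreal_ge: "ennreal (\<Sum>i\<in>A. x i) \<le> (\<Sum>i\<in>A. ennreal (x i))"
proof -
  have "ennreal (\<Sum>i\<in>A. x i) \<le> ennreal (\<Sum>i\<in>A. max 0 (x i))"
    by (intro ennreal_leI sum_mono) auto
  also have "\<dots> = (\<Sum>i\<in>A. ennreal (max 0 (x i)))"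
    by (rule sum_ennreal[symmetric]) simp
  also have "\<dots> = (\<Sum>i\<in>A. ennreal (x i))"
    by (intro sum.cong) (auto simp: max_def ennreal_neg)
  finally show ?thesis .
qed

text \<open>Pairs the vertices of the cube of subsets along the edges in direction
  \<open>k\<close>.\<close>

lemma sum_Pow_remove:
  fixes g :: "'a set \<Rightarrow> 'b :: comm_monoid_add"
  assumes "finite A" "k \<in> A"
  shows "(\<Sum>S\<in>Pow A. g S) = (\<Sum>S\<in>Pow (A - {k}). g S + g (insert k S))"
proof -
  have "Pow A = Pow (A - {k}) \<union> insert k ` Pow (A - {k})"
    using Pow_insert[of k "A - {k}"] assms by (simp add: insert_absorb)
  moreover have "Pow (A - {k}) \<inter> insert k ` Pow (A - {k}) = {}" by auto
  moreover have "inj_on (insert k) (Pow (A - {k}))" by (auto simp: inj_on_def)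
  ultimately show ?thesis
    using assms by (simp add: sum.union_disjoint sum.reindex sum.distrib)
qed

text \<open>The point is that the Hellinger series converges, so that \<open>suminf\<close>
  dominates its partial sums: each term is at most the sum of two mass functions.\<close>

lemma hellinger_sq_ge_sum:
  assumes "finite A" "G \<in> nonneg_prob_measures"
  shows "(\<Sum>y\<in>A. (sqrt (pmf P y) - sqrt (poisson_mixture G y))\<^sup>2)
    \<le> hellinger_sq (pmf P) (poisson_mixture G)"
  unfolding hellinger_sq_def
proof (rule sum_le_suminf)
  have sm: "summable (pmf Q)" for Q :: "nat pmf"
    using integrable_pmf[of UNIV Q] by (simp add: integrable_count_space_nat_iff)
  have "norm ((sqrt (pmf P y) - sqrt (poisson_mixture G y))\<^sup>2) \<le> pmf P y + pmf (mixture_pmf G) y" for y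
  proof -
    have "(sqrt a - sqrt b)\<^sup>2 \<le> a + b" if "a \<ge> 0" "b \<ge> 0" for a b :: real
      using that by (simp add: power2_diff)
    then show ?thesis
      using poisson_mixture_nonneg[OF assms(2)] by (simp add: pmf_mixture_pmf[OF assms(2)])
  qed
  then show "summable (\<lambda>y. (sqrt (pmf P y) - sqrt (poisson_mixture G y))\<^sup>2)"
    by (intro summable_comparison_test'[OF summable_add[OF sm sm]])
qed (use assms in auto)

text \<open>On disjoint bins the local losses add up to at most the Hellinger loss. Averaging over
  all \<open>S\<close> and pairing \<open>S\<close> with \<open>insert k S\<close> reduces each bin
  to a two-point problem. Each component needs mass \<open>q\<close> on its own bin; leakage into
  foreign bins is controlled only in total.\<close>

lemma minimax_lower_bound:
  fixes n K :: nat and \<theta> :: "nat \<Rightarrow> real" and I :: "nat \<Rightarrow> nat set"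
  assumes n: "n > 0" and K: "K \<le> 2 * n" and \<theta>: "\<And>i. \<theta> i \<ge> 0"
    and fin: "\<And>k. finite (I k)" and I0: "\<And>k. 0 \<notin> I k"
    and disj: "disjoint_family_on I {..<K}"
    and q: "q \<ge> 0" and mass: "\<And>k. k < K \<Longrightarrow> q \<le> (\<Sum>y\<in>I k. poisson_mass y (\<theta> k))"
    and mom: "(\<Sum>k<K. \<theta> k powr p) \<le> 2 * real n * M"
  shows "ennreal (q\<^sup>2 * real K / (64 * real n))
    \<le> (INF fhat \<in> density_estimates n. SUP G \<in> moment_class p M. hellinger_risk n fhat G)"
proof (rule INF_greatest)
  fix fhat assume fhat: "fhat \<in> density_estimates n"
  \<comment> \<open>Twice the sample size: by Bernoulli's inequality the overlap after
    \<open>n\<close> observations is at least 1 - n / N = 1/2.\<close>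
  define N where "N = 2 * n"
  have N: "N > 0" "K \<le> N" using n K by (auto simp: N_def)
  define G where "G = sparse_prior N \<theta>"
  define R where "R = (SUP G \<in> moment_class p M. hellinger_risk n fhat G)"
  define loss where "loss k S Y = ennreal (\<Sum>y\<in>I k. (sqrt (pmf (fhat Y) y) - sqrt (poisson_mixture (G S) y))\<^sup>2)"
    for k S Y
  define L where "L k S = (\<integral>\<^sup>+Y. loss k S Y \<partial>sample_law n (G S))" for k S
  have G: "G S \<in> nonneg_prob_measures" for S
    unfolding G_def using N(1) \<theta> by (rule sparse_prior_prob)
  have Gm: "G S \<in> moment_class p M" if "S \<subseteq> {..<K}" for S
  proof -
    have "(\<Sum>i<N. (if i \<in> S then \<theta> i else 0) powr p) = (\<Sum>i\<in>{..<N} \<inter> S. \<theta> i powr p)"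
      by (auto simp: sum.inter_restrict intro!: sum.cong)
    also have "\<dots> \<le> (\<Sum>i<K. \<theta> i powr p)"
      using that by (intro sum_mono2) auto
    also have "\<dots> \<le> M * real N" using mom by (simp add: N_def mult_ac)
    finally show ?thesis
      using N(1) G[of S] unfolding moment_class_def G_def
      by (auto simp: moment_sparse_prior[OF N(1) \<theta>] divide_le_eq intro!: ennreal_leI)
  qed
  have sets: "sets (sample_law n (G S)) = sets (\<Pi>\<^sub>M i\<in>{..<n}. count_space UNIV)" for S
    unfolding sample_law_def by (intro sets_PiM_cong) auto
  have [measurable]: "(\<lambda>Y. pmf (fhat Y) y) \<in> borel_measurable (\<Pi>\<^sub>M i\<in>{..<n}. count_space UNIV)" for y
    using fhat by (simp add: density_estimates_def)
  have loss_meas: "loss k S \<in> borel_measurable (\<Pi>\<^sub>M i\<in>{..<n}. count_space UNIV)" for k S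
    unfolding loss_def by measurable
  have risk: "(\<Sum>k<K. L k S) \<le> R" if "S \<subseteq> {..<K}" for S
  proof -
    have "(\<Sum>k<K. L k S) = (\<integral>\<^sup>+Y. (\<Sum>k<K. loss k S Y) \<partial>sample_law n (G S))"
      unfolding L_def using loss_meas
      by (intro nn_integral_sum[symmetric]) (simp add: measurable_cong_sets[OF sets refl])
    also have "\<dots> \<le> hellinger_risk n fhat (G S)"
      unfolding hellinger_risk_def
    proof (intro nn_integral_mono)
      fix Y
      let ?g = "\<lambda>y. (sqrt (pmf (fhat Y) y) - sqrt (poisson_mixture (G S) y))\<^sup>2"
      have "(\<Sum>k<K. loss k S Y) = ennreal (\<Sum>k<K. \<Sum>y\<in>I k. ?g y)"
        unfolding loss_def by (intro sum_ennreal sum_nonneg) auto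
      also have "(\<Sum>k<K. \<Sum>y\<in>I k. ?g y) = (\<Sum>y\<in>(\<Union>k<K. I k). ?g y)"
        using disj fin by (intro sum.UNION_disjoint[symmetric]) (auto simp: disjoint_family_on_def)
      also have "\<dots> \<le> hellinger_sq (pmf (fhat Y)) (poisson_mixture (G S))"
        using fin by (intro hellinger_sq_ge_sum G) auto
      finally show "(\<Sum>k<K. loss k S Y) \<le> ennreal (hellinger_sq (pmf (fhat Y)) (poisson_mixture (G S)))"
        by (simp add: ennreal_leI)
    qed
    also have "\<dots> \<le> R" unfolding R_def by (intro SUP_upper Gm that)
    finally show ?thesis .
  qed
  \<comment> \<open>Lower bound, free of \<open>S\<close>, for the separation of neighbours on bin
    \<open>k\<close>, with the free parameter set to \<open>q\<close>. Its sign is not controlled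
    for a single \<open>k\<close>, only its sum over \<open>k\<close> is.\<close>
  define e where "e k = (2 * q * (\<Sum>y\<in>I k. poisson_mass y (\<theta> k))
      - q\<^sup>2 * (\<Sum>y\<in>I k. \<Sum>j<K. poisson_mass y (\<theta> j))) / (4 * real N)" for k
  have pair: "ennreal (e k / 4) \<le> L k S + L k (insert k S)" if "k < K" "S \<subseteq> {..<K} - {k}" for k S
  proof -
    let ?f = "\<lambda>S. poisson_mixture (G S)"
    have k: "k < N" "k \<notin> S" using that N by auto
    have "e k \<le> (\<Sum>y\<in>I k. (sqrt (?f S y) - sqrt (?f (insert k S) y))\<^sup>2)"
    proof -
      have "e k = (\<Sum>y\<in>I k. (2 * q * poisson_mass y (\<theta> k)
          - q\<^sup>2 * (\<Sum>j<K. poisson_mass y (\<theta> j))) / (4 * real N))"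
        by (simp add: e_def sum_divide_distrib[symmetric] sum_subtractf sum_distrib_left)
      also have "\<dots> \<le> (\<Sum>y\<in>I k. (sqrt (?f S y) - sqrt (?f (insert k S) y))\<^sup>2)"
        unfolding G_def
      proof (intro sum_mono sparse_prior_sqrt_diff[OF N(1) \<theta> N(2)])
        show "y > 0" if "y \<in> I k" for y using I0[of k] that by (cases y) auto
      qed (use that in auto)
      finally show ?thesis .
    qed
    \<comment> \<open>The squared triangle inequality through the estimate: it cannot be close to
      both neighbours on the bin.\<close>
    also have "\<dots> \<le> (\<Sum>y\<in>I k. 2 * (sqrt (pmf (fhat Y) y) - sqrt (?f S y))\<^sup>2
        + 2 * (sqrt (pmf (fhat Y) y) - sqrt (?f (insert k S) y))\<^sup>2)" for Y
    proof (intro sum_mono)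
      have "(a - b)\<^sup>2 \<le> 2 * (x - a)\<^sup>2 + 2 * (x - b)\<^sup>2" for a b x :: real
        using zero_le_power2[of "(x - a) + (x - b)"] by (simp add: power2_eq_square algebra_simps)
      then show "(sqrt (?f S y) - sqrt (?f (insert k S) y))\<^sup>2
          \<le> 2 * (sqrt (pmf (fhat Y) y) - sqrt (?f S y))\<^sup>2
            + 2 * (sqrt (pmf (fhat Y) y) - sqrt (?f (insert k S) y))\<^sup>2" for y .
    qed
    finally have e_le: "e k \<le> (\<Sum>y\<in>I k. 2 * (sqrt (pmf (fhat Y) y) - sqrt (?f S y))\<^sup>2
        + 2 * (sqrt (pmf (fhat Y) y) - sqrt (?f (insert k S) y))\<^sup>2)" for Y .
    have "e k / 2 \<le> (\<Sum>y\<in>I k. (sqrt (pmf (fhat Y) y) - sqrt (?f S y))\<^sup>2)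
        + (\<Sum>y\<in>I k. (sqrt (pmf (fhat Y) y) - sqrt (?f (insert k S) y))\<^sup>2)" for Y
      using e_le[of Y] by (simp add: sum.distrib sum_distrib_left[symmetric])
    then have d: "ennreal (e k / 2) \<le> loss k S Y + loss k (insert k S) Y" for Y
      unfolding loss_def by (subst ennreal_plus[symmetric]) (auto intro!: sum_nonneg ennreal_leI)
    have "1 / 2 \<le> (1 - 1 / real N) ^ n"
      using Bernoulli_inequality[of "- (1 / real N)" n] n by (simp add: N_def)
    then have "ennreal (1 / 2) \<le> ennreal ((1 - 1 / real N) ^ n)"
      by (rule ennreal_leI)
    also have "\<dots> = ennreal (1 - 1 / real N) ^ n"
      using N by (intro ennreal_power[symmetric]) auto
    also have "\<dots> \<le> (\<Sum>y. ennreal (min (?f S y) (?f (insert k S) y))) ^ n"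
      unfolding G_def by (intro power_mono sparse_prior_overlap N \<theta> k) auto
    finally have half: "ennreal (1 / 2) \<le> (\<Sum>y. ennreal (min (?f S y) (?f (insert k S) y))) ^ n" .
    have "ennreal (e k / 4) = ennreal (e k / 2) * ennreal (1 / 2)"
      by (subst ennreal_mult''[symmetric]) auto
    also have "\<dots> \<le> ennreal (e k / 2) * (\<Sum>y. ennreal (min (?f S y) (?f (insert k S) y))) ^ n"
      by (intro mult_left_mono half) auto
    also have "\<dots> \<le> L k S + L k (insert k S)"
      using pmf_product_le_cam[OF finite_lessThan loss_meas loss_meas d, where P = "mixture_pmf (G S)"
          and Q = "mixture_pmf (G (insert k S))"]
      by (simp add: L_def sample_law_def pmf_mixture_pmf[OF G])
    finally show ?thesis .
  qed
  \<comment> \<open>Foreign components may crowd one bin, but over the disjoint union of the bins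
    each component has mass at most 1. Hence the gain 2 q^2 K exceeds the correction by at least q^2
    K.\<close>
  have "(\<Sum>k<K. \<Sum>y\<in>I k. \<Sum>j<K. poisson_mass y (\<theta> j)) \<le> real K"
  proof -
    have "(\<Sum>k<K. \<Sum>y\<in>I k. \<Sum>j<K. poisson_mass y (\<theta> j))
        = (\<Sum>y\<in>(\<Union>k<K. I k). \<Sum>j<K. poisson_mass y (\<theta> j))"
      using disj fin by (intro sum.UNION_disjoint[symmetric]) (auto simp: disjoint_family_on_def)
    also have "\<dots> = (\<Sum>j<K. \<Sum>y\<in>(\<Union>k<K. I k). poisson_mass y (\<theta> j))"
      by (rule sum.swap)
    also have "\<dots> \<le> (\<Sum>j<K. 1)"
    proof (rule sum_mono)
      fix j
      have s: "(\<lambda>y. poisson_mass y (\<theta> j)) sums 1" by (rule poisson_mass_sums(2)[OF \<theta>])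
      show "(\<Sum>y\<in>(\<Union>k<K. I k). poisson_mass y (\<theta> j)) \<le> 1"
        using sum_le_suminf[OF sums_summable[OF s], of "\<Union>k<K. I k"] fin
        by (auto simp: sums_unique[OF s, symmetric] poisson_mass_sums(1)[OF \<theta>])
    qed
    finally show ?thesis by simp
  qed
  then have "q\<^sup>2 * (\<Sum>k<K. \<Sum>y\<in>I k. \<Sum>j<K. poisson_mass y (\<theta> j)) \<le> q\<^sup>2 * real K"
    by (intro mult_left_mono) auto
  moreover have "2 * q * (real K * q) \<le> 2 * q * (\<Sum>k<K. \<Sum>y\<in>I k. poisson_mass y (\<theta> k))"
    using sum_mono[of "{..<K}" "\<lambda>_. q"] mass q by (intro mult_left_mono) auto
  ultimately have "q\<^sup>2 * real K \<le> 2 * q * (\<Sum>k<K. \<Sum>y\<in>I k. poisson_mass y (\<theta> k))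
      - q\<^sup>2 * (\<Sum>k<K. \<Sum>y\<in>I k. \<Sum>j<K. poisson_mass y (\<theta> j))"
    by (simp add: power2_eq_square algebra_simps)
  then have "q\<^sup>2 * real K / (4 * real N) \<le> (\<Sum>k<K. e k)"
    using N unfolding e_def
    by (simp add: sum_divide_distrib[symmetric] sum_subtractf sum_distrib_left[symmetric] divide_right_mono)
  then have e: "q\<^sup>2 * real K / (64 * real n) \<le> (\<Sum>k<K. e k) / 8"
    by (simp add: N_def mult.commute)
  \<comment> \<open>Direction \<open>k\<close> splits the 2^K subsets into 2^K / 2 pairs, each worth
    \<open>e k / 4\<close>; this is the origin of the factor 1/8.\<close>
  have "ennreal (2 ^ K) * ennreal ((\<Sum>k<K. e k) / 8) = ennreal (\<Sum>k<K. 2 ^ K / 2 * (e k / 4))"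
    by (subst ennreal_mult'[symmetric])
       (auto simp: sum_distrib_left[symmetric] sum_divide_distrib[symmetric])
  also have "\<dots> \<le> (\<Sum>k<K. ennreal (2 ^ K / 2 * (e k / 4)))"
    by (rule sum_ennreal_ge)
  also have "\<dots> = (\<Sum>k<K. \<Sum>S\<in>Pow ({..<K} - {k}). ennreal (e k / 4))"
  proof (intro sum.cong refl)
    fix k assume "k \<in> {..<K}"
    then have "2 ^ K / 2 = real (card (Pow ({..<K} - {k})))"
      by (cases K) (auto simp: card_Pow)
    then show "ennreal (2 ^ K / 2 * (e k / 4)) = (\<Sum>S\<in>Pow ({..<K} - {k}). ennreal (e k / 4))"
      by (simp add: ennreal_mult'[symmetric] ennreal_of_nat_eq_real_of_nat)
  qed
  also have "\<dots> \<le> (\<Sum>k<K. \<Sum>S\<in>Pow ({..<K} - {k}). L k S + L k (insert k S))"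
    by (intro sum_mono pair) auto
  also have "\<dots> = (\<Sum>k<K. \<Sum>S\<in>Pow {..<K}. L k S)"
    by (intro sum.cong refl sum_Pow_remove[symmetric]) auto
  also have "\<dots> = (\<Sum>S\<in>Pow {..<K}. \<Sum>k<K. L k S)"
    by (rule sum.swap)
  also have "\<dots> \<le> (\<Sum>S\<in>Pow {..<K}. R)"
    by (intro sum_mono risk) auto
  also have "\<dots> = ennreal (2 ^ K) * R"
    by (simp add: card_Pow ennreal_power[symmetric])
  finally have "ennreal ((\<Sum>k<K. e k) / 8) \<le> R"
    by (subst (asm) ennreal_mult_le_mult_iff) auto
  then show "ennreal (q\<^sup>2 * real K / (64 * real n)) \<le> R"
    using e by (meson ennreal_leI order_trans)
qed

section \<open>Concrete families of bins\<close>

text \<open>Each bin extends two standard deviations to either side of its mean, so by Chebyshev each of them carries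
  mass at least 3/4 of its own Poisson component.\<close>

lemma minimax_lower_bound_square_bins:
  fixes n K :: nat
  assumes n: "n > 0" and K: "K \<le> 2 * n" and p: "p > 0"
    and mom: "real K * (4 * (real K)\<^sup>2) powr p \<le> 2 * real n * M"
  shows "ennreal (9 * real K / (1024 * real n))
    \<le> (INF fhat \<in> density_estimates n. SUP G \<in> moment_class p M. hellinger_risk n fhat G)"
proof -
  \<comment> \<open>The mean 4 b^2 has standard deviation 2 b. Starting at b = 1 makes the first bin
    the open interval (0, 8), which avoids 0.\<close>
  define b where "b k = real (Suc k)" for k
  \<comment> \<open>Consecutive bins touch, since 4 b^2 + 4 b = 4 (b + 1)^2 - 4 (b + 1); the strict
    inequality keeps them disjoint.\<close>
  define I where "I k = {y::nat. \<bar>real y - 4 * (b k)\<^sup>2\<bar> < 4 * b k}" for k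
  have b: "b k \<ge> 1" for k by (simp add: b_def)
  have fin: "finite (I k)" for k
  proof (rule finite_subset)
    show "I k \<subseteq> {..8 * (Suc k)\<^sup>2}"
    proof
      fix y assume "y \<in> I k"
      then have "real y < 4 * (b k)\<^sup>2 + 4 * b k" by (auto simp: I_def)
      also have "\<dots> \<le> 8 * (b k)\<^sup>2" using b[of k] by (simp add: power2_eq_square)
      also have "\<dots> = real (8 * (Suc k)\<^sup>2)" by (simp add: b_def)
      finally show "y \<in> {..8 * (Suc k)\<^sup>2}" by (simp only: of_nat_less_iff atMost_iff less_imp_le)
    qed
  qed auto
  have sep: "I k \<inter> I l = {}" if "k < l" for k l
  proof -
    have kl: "b k + 1 \<le> b l" using that by (simp add: b_def)
    then have "b k * (b k + 1) \<le> (b l - 1) * b l"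
      using b[of k] by (intro mult_mono) auto
    then have "4 * (b k)\<^sup>2 + 4 * b k \<le> 4 * (b l)\<^sup>2 - 4 * b l"
      by (simp add: power2_eq_square algebra_simps)
    then show ?thesis by (auto simp: I_def)
  qed
  have "ennreal ((3/4)\<^sup>2 * real K / (64 * real n))
    \<le> (INF fhat \<in> density_estimates n. SUP G \<in> moment_class p M. hellinger_risk n fhat G)"
  proof (rule minimax_lower_bound[where \<theta> = "\<lambda>k. 4 * (b k)\<^sup>2" and I = I, OF n K _ fin])
    show "0 \<notin> I k" for k
      using b[of k] by (simp add: I_def power2_eq_square)
    show "disjoint_family_on I {..<K}"
      unfolding disjoint_family_on_def using sep by (metis Int_commute linorder_neqE_nat)
    show "3 / 4 \<le> (\<Sum>y\<in>I k. poisson_mass y (4 * (b k)\<^sup>2))" if "k < K" for k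
      using poisson_chebyshev[of "4 * (b k)\<^sup>2" "4 * b k" "I k"] b[of k] fin
      by (simp add: I_def power_mult_distrib)
    have "(\<Sum>k<K. (4 * (b k)\<^sup>2) powr p) \<le> (\<Sum>k<K. (4 * (real K)\<^sup>2) powr p)"
      using p by (intro sum_mono powr_mono2 mult_left_mono power_mono) (auto simp: b_def)
    also have "\<dots> \<le> 2 * real n * M" using mom by simp
    finally show "(\<Sum>k<K. (4 * (b k)\<^sup>2) powr p) \<le> 2 * real n * M" .
  qed auto
  then show ?thesis by (simp add: power2_eq_square)
qed

lemma minimax_lower_bound_single:
  fixes n :: nat
  assumes n: "n > 0" and \<theta>: "\<theta> \<ge> 0" and mom: "\<theta> powr p \<le> 2 * real n * M"
  shows "ennreal ((exp (- \<theta>) * \<theta>)\<^sup>2 / (64 * real n))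
    \<le> (INF fhat \<in> density_estimates n. SUP G \<in> moment_class p M. hellinger_risk n fhat G)"
  using minimax_lower_bound[of n 1 "\<lambda>_. \<theta>" "\<lambda>_. {1}" "exp (- \<theta>) * \<theta>" p M] assms
  by (simp add: poisson_mass_def disjoint_family_on_def)

section \<open>Choice of the number of bins and comparison with the rate\<close>

theorem theorem2:
  fixes p :: real
  assumes "p > 0"
  shows "\<exists>c::real. c > 0 \<and>
    (\<forall>(n::nat) (M::real).
       n \<ge> 2 \<longrightarrow> M > 0 \<longrightarrow>
       real n powr (- 1 / p) * ln (real n) ^ 10 \<le> M powr (1 / p) \<longrightarrow>
       M powr (1 / p) \<le> real n ^ 2 * ln (real n) ^ 2 \<longrightarrow>
       (INF fhat \<in> density_estimates n. SUP G \<in> moment_class p M. hellinger_risk n fhat G)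
         \<ge> ennreal (c * real n powr (- (2 * p) / (2 * p + 1)) * M powr (1 / (2 * p + 1))
              / ln (real n) ^ 11))"
proof (intro exI[of _ "1 / 2 ^ 40"] conjI allI impI)
  fix n :: nat and M :: real
  assume "n \<ge> 2" and M: "M > 0"
    and lower: "real n powr (- 1 / p) * ln (real n) ^ 10 \<le> M powr (1 / p)"
    and upper: "M powr (1 / p) \<le> real n ^ 2 * ln (real n) ^ 2"
  let ?risk = "INF fhat \<in> density_estimates n. SUP G \<in> moment_class p M. hellinger_risk n fhat G"
  define l where "l = ln (real n)"
  define s where "s = 2 * p + 1"
  \<comment> \<open>\<open>T / real n\<close> is the claimed rate without constant and logarithms.
    The number \<open>x\<close> is the real solution of 4^p x^(2p+1) = 2 n M, where the moment
    constraint for square bins is tight.\<close>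
  define T where "T = (real n * M) powr (1 / s)"
  define x where "x = (2 * real n * M / 4 powr p) powr (1 / s)"
  have n: "real n \<ge> 2" "n > 0" using \<open>n \<ge> 2\<close> by auto
  have s: "s > 1" using assms by (simp add: s_def)
  have "ln 2 \<le> l" using n by (simp add: l_def)
  then have l: "l \<ge> 1 / 2" using ln2_ge_two_thirds by simp
  have T0: "T \<ge> 0" by (simp add: T_def)
  have rate: "1 / 2 ^ 40 * real n powr (- (2 * p) / (2 * p + 1)) * M powr (1 / (2 * p + 1)) / ln (real n) ^ 11
      = T / (2 ^ 40 * real n * l ^ 11)"
  proof -
    have "- (2 * p) / s = 1 / s - 1" using s by (simp add: s_def field_simps)
    then have "real n powr (- (2 * p) / s) = real n powr (1 / s) / real n"
      using n by (simp add: powr_diff)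
    then show ?thesis
      using M n by (simp add: T_def s_def[symmetric] l_def powr_mult)
  qed
  \<comment> \<open>The constant splits as 2^40 = 2^29 * 2^11: the factor 2^11 pays for
    \<open>l\<close> being possibly as small as 1/2, and 2^29 is what the single-atom case
    requires.\<close>
  have rate_le: "ennreal (T / (2 ^ 40 * real n * l ^ 11)) \<le> ?risk"
    if "ennreal r \<le> ?risk" "T / (2 ^ 29 * real n) \<le> r" for r
  proof -
    have "(1 / 2) ^ 11 \<le> l ^ 11" using l by (intro power_mono) auto
    then have "T / (2 ^ 40 * real n * l ^ 11) \<le> T / (2 ^ 40 * real n * (1 / 2) ^ 11)"
      using T0 n l by (intro divide_left_mono mult_left_mono mult_pos_pos) auto
    also have "\<dots> \<le> r" using that(2) by (simp add: power_divide)
    finally show ?thesis using that(1) by (meson ennreal_leI order_trans)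
  qed
  have "x = (2 / 4 powr p) powr (1 / s) * T"
    using M n unfolding x_def T_def by (subst powr_mult[symmetric]) (auto simp: mult.assoc)
  also have "2 / 4 powr p = 2 powr (1 - 2 * p)"
    using powr_powr[of 2 2 p] by (simp add: powr_diff)
  also have "(2 powr (1 - 2 * p)) powr (1 / s) = 2 powr ((1 - 2 * p) / s)"
    by (simp add: powr_powr)
  finally have x_eq: "x = 2 powr ((1 - 2 * p) / s) * T" .
  \<comment> \<open>The exponent equals 2 / (2p + 1) - 1, hence exceeds -1 for every
    \<open>p\<close>; this keeps the constant independent of \<open>p\<close>.\<close>
  have "2 powr (- 1) \<le> 2 powr ((1 - 2 * p) / s)"
    using s assms by (intro powr_mono) (auto simp: s_def field_simps)
  then have xT: "T / 2 \<le> x"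
    using mult_right_mono[OF _ T0, of "1 / 2"] by (simp add: x_eq powr_minus_divide)
  have "ennreal (T / (2 ^ 40 * real n * l ^ 11)) \<le> ?risk"
  proof (cases "x < 1")
    case True
    \<comment> \<open>The least value that \<open>l ^ 10\<close> can be guaranteed to reach from
      \<open>l \<ge> 1 / 2\<close>, so the lower bound on \<open>M\<close> yields the moment
      condition for this atom.\<close>
    define \<theta> :: real where "\<theta> = (1 / 2) ^ 10"
    have "\<theta> powr p \<le> 2 * real n * M"
    proof -
      have "real n powr (- 1 / p) * \<theta> \<le> real n powr (- 1 / p) * l ^ 10"
        unfolding \<theta>_def using l by (intro mult_left_mono power_mono) auto
      also have "\<dots> \<le> M powr (1 / p)" using lower by (simp add: l_def)
      finally have "(real n powr (- 1 / p) * \<theta>) powr p \<le> (M powr (1 / p)) powr p"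
        using assms by (intro powr_mono2) (auto simp: \<theta>_def)
      then have "\<theta> powr p / real n \<le> M"
        using assms M n by (simp add: powr_mult powr_powr powr_minus_divide powr_divide \<theta>_def)
      then have "\<theta> powr p \<le> real n * M" using n by (simp add: field_simps)
      also have "\<dots> \<le> 2 * real n * M" using M n by simp
      finally show ?thesis .
    qed
    then have risk: "ennreal ((exp (- \<theta>) * \<theta>)\<^sup>2 / (64 * real n)) \<le> ?risk"
      using n by (intro minimax_lower_bound_single) (auto simp: \<theta>_def)
    show ?thesis
    proof (rule rate_le[OF risk])
      have "1 - \<theta> \<le> exp (- \<theta>)" using exp_ge_add_one_self[of "- \<theta>"] by simp
      then have "1 / 2 \<le> exp (- \<theta>)" by (simp add: \<theta>_def power_divide)
      then have "(1 / 2 * \<theta>)\<^sup>2 \<le> (exp (- \<theta>) * \<theta>)\<^sup>2"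
        by (intro power_mono mult_right_mono) (auto simp: \<theta>_def)
      moreover have "T \<le> 2" using True xT by simp
      ultimately have "T / 2 ^ 29 \<le> (exp (- \<theta>) * \<theta>)\<^sup>2 / 64"
        by (simp add: \<theta>_def power2_eq_square power_divide)
      then show "T / (2 ^ 29 * real n) \<le> (exp (- \<theta>) * \<theta>)\<^sup>2 / (64 * real n)"
        using n by (simp add: field_simps)
    qed
  next
    case False
    \<comment> \<open>As many bins as the moment constraint and the 2n indices both permit. The
      minimum is at least 1, so rounding down costs at most a factor 2.\<close>
    define K where "K = nat \<lfloor>min x (2 * real n)\<rfloor>"
    have m: "min x (2 * real n) \<ge> 1" using False n by auto
    have "1 \<le> \<lfloor>min x (2 * real n)\<rfloor>" using m by (simp only: one_le_floor)
    then have K: "real K = of_int \<lfloor>min x (2 * real n)\<rfloor>" "real K \<ge> 1"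
      by (auto simp: K_def)
    have K_le: "real K \<le> min x (2 * real n)" unfolding K(1) by (rule of_int_floor_le)
    have K_ge: "min x (2 * real n) / 2 \<le> real K"
      using K(2) real_of_int_floor_add_one_gt[of "min x (2 * real n)"] unfolding K(1) by linarith
    have K_pos: "real K > 0" using K(2) by linarith
    have "real K * (4 * (real K)\<^sup>2) powr p = 4 powr p * real K powr s"
    proof -
      have "((real K)\<^sup>2) powr p = real K powr (2 * p)"
        using powr_powr[of "real K" 2 p] K_pos by simp
      then show ?thesis
        using K_pos by (simp add: powr_mult s_def powr_add)
    qed
    also have "\<dots> \<le> 4 powr p * x powr s"
      using K_le s by (intro mult_left_mono powr_mono2) auto
    also have "\<dots> = 2 * real n * M"
      using s M n by (simp add: x_def powr_powr)
    finally have risk: "ennreal (9 * real K / (1024 * real n)) \<le> ?risk"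
      using K_le n assms by (intro minimax_lower_bound_square_bins) auto
    show ?thesis
    proof (cases "x \<le> 2 * real n")
      case True
      then have "T \<le> 4 * real K" using K_ge xT by simp
      then have "T / 2 ^ 29 \<le> 9 * real K / 1024" using K_pos by simp
      then have "T / (2 ^ 29 * real n) \<le> 9 * real K / (1024 * real n)"
        using n by (simp add: field_simps)
      then show ?thesis by (rule rate_le[OF risk])
    next
      case x_large: False
      \<comment> \<open>Here the number of indices limits \<open>K\<close>, so K is at least n and
        the risk is bounded below by a constant. The upper bound on \<open>M\<close> gives T / n at
        most 2 l, and the division by \<open>l ^ 11\<close> brings the target below that
        constant.\<close>
      have "M = (M powr (1 / p)) powr p" using assms M by (simp add: powr_powr)
      also have "\<dots> \<le> ((real n * l) powr 2) powr p"
        using assms upper n l by (intro powr_mono2) (auto simp: l_def power_mult_distrib)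
      also have "\<dots> = (real n * l) powr (2 * p)" by (simp add: powr_powr)
      \<comment> \<open>Since 2 l is at least 1, the remaining factor n of n M also fits below n (2
        l).\<close>
      also have "\<dots> \<le> (real n * (2 * l)) powr (2 * p)"
        using assms n l by (intro powr_mono2 mult_left_mono) auto
      finally have "real n * M \<le> (real n * (2 * l)) * (real n * (2 * l)) powr (2 * p)"
        using n l M by (intro mult_mono) auto
      also have "\<dots> = (real n * (2 * l)) powr s"
        using n l by (simp add: s_def powr_add)
      finally have "T \<le> ((real n * (2 * l)) powr s) powr (1 / s)"
        unfolding T_def using s M n by (intro powr_mono2) auto
      then have T: "T \<le> real n * (2 * l)" using s n l by (simp add: powr_powr)
      have "(1 / 2) ^ 10 \<le> l ^ 10" using l by (intro power_mono) auto
      have "T / (2 ^ 40 * real n * l ^ 11) \<le> real n * (2 * l) / (2 ^ 40 * real n * l ^ 11)"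
        using T n l by (intro divide_right_mono) auto
      also have "\<dots> = 1 / (2 ^ 39 * l ^ 10)"
        using n l by (simp add: field_simps power_numeral_reduce)
      also have "\<dots> \<le> 1 / (2 ^ 39 * (1 / 2) ^ 10)"
        using l by (intro divide_left_mono mult_left_mono power_mono mult_pos_pos) auto
      also have "\<dots> \<le> 9 * real n / (1024 * real n)" using n by (simp add: power_divide)
      also have "\<dots> \<le> 9 * real K / (1024 * real n)"
        using K_ge x_large n by (intro divide_right_mono) auto
      finally show ?thesis using risk by (meson ennreal_leI order_trans)
    qed
  qed
  then show "ennreal (1 / 2 ^ 40 * real n powr (- (2 * p) / (2 * p + 1)) * M powr (1 / (2 * p + 1))
              / ln (real n) ^ 11) \<le> ?risk"
    unfolding rate .
qed simp

end
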